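(* Consider $f(x)=\frac1n\sum_{i=1}^n f_i(x)$, $x\in\mathbb{R}^d$. Assume there exists $f_*\in\mathbb{R}$ with $f(x)\ge f_*$ for all $x\in\mathbb{R}^d$, and that $f_i$ is $L_i$-smooth for all $i\in\{1,\dots,n\}$, i.e. $\|\nabla f_i(x)-\nabla f_i(y)\|\le L_i\|x-y\|$ for all $x,y\in\mathbb{R}^d$. Let $\mathcal{Q}$ be a quantization operator with parameter $\omega$ and expected density $\zeta_{\mathcal Q}$, let $p\in(0,1]$, and let $$\gamma\le\frac{1}{L\left(1+\sqrt{\frac{(1-p)\omega}{pn}}\right)},\qquad L^2=\frac1n\sum_{i=1}^nL_i^2.$$ Then after $K$ iterations of MARINA we have $$\mathbf{E}\left[\|\nabla f(\hat x^K)\|^2\right]\le\frac{2\Delta_0}{\gamma K},$$ where $\hat x^K$ is chosen uniformly at random from $x^0,\dots,x^{K-1}$ and $\Delta_0=f(x^0)-f_*$. That is, after $$K=\mathcal{O}\left(\frac{\Delta_0L}{\varepsilon^2}\left(1+\sqrt{\frac{(1-p)\omega}{pn}}\right)\right)$$ iterations MARINA produces such a point $\hat x^K$ that $\mathbf{E}[\|\nabla f(\hat x^K)\|^2]\le\varepsilon^2$. Moreover, under an assumption that the communication cost is proportional to the number of non-zero components of transmitted vectors from workers to the server, the expected total communication cost per worker equals $$d+K(pd+(1-p)\zeta_{\mathcal Q})=\mathcal{O}\left(d+\frac{\Delta_0L}{\varepsilon^2}\left(1+\sqrt{\frac{(1-p)\omega}{pn}}\right)(pd+(1-p)\zeta_{\mathcal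 Q})\right).$$
   Context: $\|\cdot\|$ is the Euclidean norm; $\|y\|_0$ is the number of non-zero components of $y\in\mathbb{R}^d$. Quantization operator: a stochastic mapping $\mathcal{Q}:\mathbb{R}^d\to\mathbb{R}^d$ for which there is $\omega>0$ with $\mathbf{E}[\mathcal{Q}(x)]=x$ and $\mathbf{E}[\|\mathcal{Q}(x)-x\|^2]\le\omega\|x\|^2$ for any $x\in\mathbb{R}^d$. Its expected density is $\zeta_{\mathcal Q}=\sup_{x\in\mathbb{R}^d}\mathbf{E}[\|\mathcal{Q}(x)\|_0]$. MARINA (a distributed method with $n$ workers, worker $i$ having access to $f_i$, and a server; input: starting point $x^0$, stepsize $\gamma$, probability $p\in(0,1]$, number of iterations $K$): initialize $g^0=\nabla f(x^0)$. For $k=0,\dots,K-1$: sample $c_k\sim\mathrm{Bernoulli}(p)$ and broadcast $g^k$ to all workers; each worker $i=1,\dots,n$ in parallel computes $x^{k+1}=x^k-\gamma g^k$ and sets $g_i^{k+1}=\nabla f_i(x^{k+1})$ if $c_k=1$, and $g_i^{k+1}=g^k+\mathcal{Q}(\nabla f_i(x^{k+1})-\nabla f_i(x^k))$ otherwise; then $g^{k+1}=\frac1n\sum_{i=1}^n g_i^{k+1}$. Return $\hat x^K$ chosen uniformly at random from $\{x^k\}_{k=0}^{K-1}$.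
   Formalization: The cost equality fails for actual non-zero counts (e.g. x^0 a common minimizer); it is proved when dense vectors are charged d and quantized ones ζ_Q; for actual counts it is an upper bound, with equality if gradients have no zero entries and the density equals ζ_Q along the run. *)

theory Defs
  imports "HOL-Probability.Probability"
begin

definition grad :: "('a::real_inner \<Rightarrow> real) \<Rightarrow> 'a \<Rightarrow> 'a" where
  "grad F x = (THE D. GDERIV F x :> D)"

lemma grad_eqI:
  assumes "GDERIV F x :> D"
  shows "grad F x = D"
  unfolding grad_def
proof (rule the_equality[where P = "\<lambda>D. GDERIV F x :> D"])
  show "GDERIV F x :> D" by (fact assms)
next
  fix D' assume "GDERIV F x :> D'"
  then have "(\<lambda>h. h \<bullet> D') = (\<lambda>h. h \<bullet> D)"
    using assms has_derivative_unique unfolding gderiv_def by blast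
  then have "(D' - D) \<bullet> D' = (D' - D) \<bullet> D" by (rule fun_cong)
  then have "(D' - D) \<bullet> (D' - D) = 0" by (simp add: inner_diff_right)
  then show "D' = D" by simp
qed

definition smooth_with :: "real \<Rightarrow> ('a::real_inner \<Rightarrow> real) \<Rightarrow> bool" where
  "smooth_with L F \<longleftrightarrow>
     (\<forall>x. F differentiable (at x)) \<and>
     (\<forall>x y. norm (grad F x - grad F y) \<le> L * norm (x - y))"

definition nnz :: "real ^ 'd \<Rightarrow> nat" where
  "nnz y = card {j. y $ j \<noteq> 0}"

(* A stochastic mapping is given by a probability space S of random seeds and a jointly
   measurable function Q: the random vector Q(v) is (\<lambda>s. Q s v) with s drawn from S. *)
definition quantization ::
    "'s measure \<Rightarrow> ('s \<Rightarrow> real ^ 'd \<Rightarrow> real ^ 'd) \<Rightarrow> real \<Rightarrow> bool" where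
  "quantization S Q \<omega> \<longleftrightarrow>
     prob_space S \<and> (\<lambda>(s, v). Q s v) \<in> borel_measurable (S \<Otimes>\<^sub>M borel) \<and> \<omega> > 0 \<and>
     (\<forall>v. integrable S (\<lambda>s. Q s v) \<and> (\<integral>s. Q s v \<partial>S) = v \<and>
          integrable S (\<lambda>s. (norm (Q s v - v))\<^sup>2) \<and>
          (\<integral>s. (norm (Q s v - v))\<^sup>2 \<partial>S) \<le> \<omega> * (norm v)\<^sup>2)"

definition density_at ::
    "'s measure \<Rightarrow> ('s \<Rightarrow> real ^ 'd \<Rightarrow> real ^ 'd) \<Rightarrow> real ^ 'd \<Rightarrow> real" where
  "density_at S Q v = (\<integral>s. real (nnz (Q s v)) \<partial>S)"

definition expected_density ::
    "'s measure \<Rightarrow> ('s \<Rightarrow> real ^ 'd \<Rightarrow> real ^ 'd) \<Rightarrow> real" where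
  "expected_density S Q = (SUP v. density_at S Q v)"

definition avg_fun :: "nat \<Rightarrow> (nat \<Rightarrow> 'a \<Rightarrow> real) \<Rightarrow> 'a \<Rightarrow> real" where
  "avg_fun n f x = (1 / real n) * (\<Sum>i=1..n. f i x)"

(* The randomness of one iteration is a pair (c, s): the coin c shared by all workers and the
   seed s i of worker i. All coins and seeds, over all iterations and workers, are independent. *)
definition run_space ::
    "real \<Rightarrow> nat \<Rightarrow> 's measure \<Rightarrow> (nat \<Rightarrow> bool \<times> (nat \<Rightarrow> 's)) measure" where
  "run_space p n S =
     (\<Pi>\<^sub>M k\<in>UNIV. measure_pmf (bernoulli_pmf p) \<Otimes>\<^sub>M (\<Pi>\<^sub>M i\<in>{1..n}. S))"

(* The vector sent by worker i in an iteration moving from x to x'. If the coin shows False the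
   receiver recovers the worker's estimator by adding the current g, which it already knows. *)
definition marina_msg ::
    "('s \<Rightarrow> 'a \<Rightarrow> 'a) \<Rightarrow> (nat \<Rightarrow> 'a \<Rightarrow> real) \<Rightarrow> bool \<times> (nat \<Rightarrow> 's) \<Rightarrow> nat \<Rightarrow> 'a \<Rightarrow> 'a::real_inner \<Rightarrow> 'a"
  where
  "marina_msg Q f cs i x x' =
     (if fst cs then grad (f i) x' else Q (snd cs i) (grad (f i) x' - grad (f i) x))"

(* The pair (x^k, g^k) as a function of the outcome r of all random draws; the draws of
   iteration k are r k and produce (x^(k+1), g^(k+1)). *)
primrec marina ::
    "nat \<Rightarrow> (nat \<Rightarrow> 'a \<Rightarrow> real) \<Rightarrow> ('s \<Rightarrow> 'a \<Rightarrow> 'a) \<Rightarrow> real \<Rightarrow> 'a::real_inner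
      \<Rightarrow> (nat \<Rightarrow> bool \<times> (nat \<Rightarrow> 's)) \<Rightarrow> nat \<Rightarrow> 'a \<times> 'a" where
  "marina n f Q \<gamma> x0 r 0 = (x0, grad (avg_fun n f) x0)"
| "marina n f Q \<gamma> x0 r (Suc k) =
     (let (x, g) = marina n f Q \<gamma> x0 r k;
          x' = x - \<gamma> *\<^sub>R g;
          gw = (\<lambda>i. if fst (r k) then marina_msg Q f (r k) i x x'
                    else g + marina_msg Q f (r k) i x x')
      in (x', (1 / real n) *\<^sub>R (\<Sum>i=1..n. gw i)))"

definition marina_x ::
    "nat \<Rightarrow> (nat \<Rightarrow> 'a \<Rightarrow> real) \<Rightarrow> ('s \<Rightarrow> 'a \<Rightarrow> 'a) \<Rightarrow> real \<Rightarrow> 'a::real_inner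
      \<Rightarrow> (nat \<Rightarrow> bool \<times> (nat \<Rightarrow> 's)) \<Rightarrow> nat \<Rightarrow> 'a" where
  "marina_x n f Q \<gamma> x0 r k = fst (marina n f Q \<gamma> x0 r k)"

(* An outcome of this space is (r, j); the returned point is marina_x ... r j. *)
definition output_space ::
    "real \<Rightarrow> nat \<Rightarrow> 's measure \<Rightarrow> nat \<Rightarrow> ((nat \<Rightarrow> bool \<times> (nat \<Rightarrow> 's)) \<times> nat) measure" where
  "output_space p n S K = run_space p n S \<Otimes>\<^sub>M measure_pmf (pmf_of_set {..<K})"

(* The number of non-zero components actually sent by worker i in K iterations, including the
   gradient at x0 needed to form g^0. *)
definition sent_nnz ::
    "nat \<Rightarrow> (nat \<Rightarrow> real ^ 'd \<Rightarrow> real) \<Rightarrow> ('s \<Rightarrow> real ^ 'd \<Rightarrow> real ^ 'd) \<Rightarrow> real \<Rightarrow> real ^ 'd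
      \<Rightarrow> nat \<Rightarrow> nat \<Rightarrow> (nat \<Rightarrow> bool \<times> (nat \<Rightarrow> 's)) \<Rightarrow> nat" where
  "sent_nnz n f Q \<gamma> x0 i K r =
     nnz (grad (f i) x0) +
     (\<Sum>k<K. nnz (marina_msg Q f (r k) i (marina_x n f Q \<gamma> x0 r k)
                                         (marina_x n f Q \<gamma> x0 r (Suc k))))"

(* The cost when an uncompressed vector is charged its full length d and a compressed one is
   charged \<zeta>, independently of the vectors actually sent. *)
definition charged_cost ::
    "nat \<Rightarrow> real \<Rightarrow> nat \<Rightarrow> (nat \<Rightarrow> bool \<times> (nat \<Rightarrow> 's)) \<Rightarrow> real" where
  "charged_cost d \<zeta> K r = real d + (\<Sum>k<K. if fst (r k) then real d else \<zeta>)"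

end

theory Submission
  imports Defs
begin

text \<open>
  The function \<open>\<Phi>(x, g) = f(x) - f\<^sub>* + \<gamma> / (2 p) \<parallel>g - \<nabla>f(x)\<parallel>\<^sup>2\<close> of the state \<open>(x\<^sup>k, g\<^sup>k)\<close> decreases in
  conditional expectation by at least \<open>\<gamma> / 2 \<parallel>\<nabla>f(x)\<parallel>\<^sup>2\<close> per iteration. The coin resets the
  estimation error with probability \<open>p\<close>; otherwise independence and unbiasedness of the quantizers
  add a variance of at most \<open>\<omega> L\<^sup>2 / n \<parallel>x\<^sup>k\<^sup>+\<^sup>1 - x\<^sup>k\<parallel>\<^sup>2\<close>. Under the stepsize bound this is absorbed by
  the term \<open>- (1 / (2 \<gamma>) - L / 2) \<parallel>x\<^sup>k\<^sup>+\<^sup>1 - x\<^sup>k\<parallel>\<^sup>2\<close> of the descent inequality. Since \<open>\<Phi> \<ge> 0\<close> and the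
  initial error vanishes, telescoping gives the rate. All estimates are carried out with
  nonnegative integrals, so that integrability comes out of the final bound.
\<close>

section \<open>Smooth functions\<close>

text \<open>A derivative on a Euclidean space is a linear functional, represented by the vector
  \<open>adjoint F' 1\<close>. So the description operator in \<open>grad\<close> denotes a genuine
  gradient wherever \<open>F\<close> is differentiable.\<close>

lemma GDERIV_grad:
  fixes F :: "'a::euclidean_space \<Rightarrow> real"
  assumes "F differentiable (at x)"
  shows "GDERIV F x :> grad F x"
proof -
  obtain F' where F': "(F has_derivative F') (at x)"
    using assms by (auto simp: differentiable_def)
  then have "linear F'"
    by (rule has_derivative_linear)
  then have "F' = (\<lambda>h. h \<bullet> adjoint F' 1)"
    by (simp add: adjoint_works fun_eq_iff)
  then have "GDERIV F x :> adjoint F' 1"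
    using F' by (simp add: gderiv_def)
  then show ?thesis
    by (simp add: grad_eqI)
qed

text \<open>Along the segment from \<open>x\<close> to \<open>y\<close>, Cauchy-Schwarz and the
  Lipschitz bound keep the slope of \<open>F\<close> below that of the quadratic model.\<close>

lemma smooth_with_descent:
  fixes F :: "'a::euclidean_space \<Rightarrow> real"
  assumes "smooth_with L F"
  shows "F y \<le> F x + grad F x \<bullet> (y - x) + L / 2 * (norm (y - x))\<^sup>2"
proof -
  define h where "h = y - x"
  \<comment> \<open>\<open>F\<close> on the segment minus the varying part of the quadratic model;
    the claim becomes \<open>\<phi> 1 \<le> \<phi> 0\<close>.\<close>
  define \<phi> where "\<phi> t = F (x + t *\<^sub>R h) - t * (grad F x \<bullet> h) - L / 2 * t\<^sup>2 * (norm h)\<^sup>2" for t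
  have "(\<phi> has_real_derivative
      h \<bullet> grad F (x + t *\<^sub>R h) - grad F x \<bullet> h - L * t * (norm h)\<^sup>2) (at t)" for t
  proof -
    have "GDERIV F (x + t *\<^sub>R h) :> grad F (x + t *\<^sub>R h)"
      using assms by (intro GDERIV_grad) (auto simp: smooth_with_def)
    then have "((\<lambda>t. F (x + t *\<^sub>R h)) has_derivative
        (\<lambda>s. (s *\<^sub>R h) \<bullet> grad F (x + t *\<^sub>R h))) (at t)"
      unfolding gderiv_def
      by (rule has_derivative_compose[rotated]) (auto intro!: derivative_eq_intros)
    then have "((\<lambda>t. F (x + t *\<^sub>R h)) has_real_derivative h \<bullet> grad F (x + t *\<^sub>R h)) (at t)"
      by (simp add: has_field_derivative_def mult.commute[of _ "h \<bullet> _"])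
    then show ?thesis
      unfolding \<phi>_def by (auto intro!: derivative_eq_intros)
  qed
  moreover have "h \<bullet> grad F (x + t *\<^sub>R h) - grad F x \<bullet> h - L * t * (norm h)\<^sup>2 \<le> 0"
    if "0 \<le> t" for t
  proof -
    have "h \<bullet> grad F (x + t *\<^sub>R h) - grad F x \<bullet> h = (grad F (x + t *\<^sub>R h) - grad F x) \<bullet> h"
      by (simp add: inner_diff_left inner_diff_right inner_commute)
    also have "\<dots> \<le> norm (grad F (x + t *\<^sub>R h) - grad F x) * norm h"
      by (rule norm_cauchy_schwarz)
    also have "\<dots> \<le> (L * norm (x + t *\<^sub>R h - x)) * norm h"
      using assms by (intro mult_right_mono) (simp_all only: smooth_with_def norm_ge_zero)
    also have "\<dots> = L * t * (norm h)\<^sup>2"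
      using that by (simp add: power2_eq_square)
    finally show ?thesis by simp
  qed
  ultimately have "\<phi> 1 \<le> \<phi> 0"
    by (intro DERIV_nonpos_imp_nonincreasing[of 0 1 \<phi>]) force+
  then show ?thesis
    by (simp add: \<phi>_def h_def)
qed

text \<open>Averaging the gradients gives the mean of the \<open>Li\<close> as Lipschitz constant;
  by Cauchy-Schwarz it is at most their root mean square \<open>L\<close>.\<close>

lemma avg_fun_smooth:
  fixes f :: "nat \<Rightarrow> 'a::euclidean_space \<Rightarrow> real"
  assumes smooth: "\<And>i. i \<in> {1..n} \<Longrightarrow> smooth_with (Li i) (f i)"
    and L: "L \<ge> 0" "L\<^sup>2 = (1 / real n) * (\<Sum>i=1..n. (Li i)\<^sup>2)"
  shows grad_avg_fun: "grad (avg_fun n f) x = (1 / real n) *\<^sub>R (\<Sum>i=1..n. grad (f i) x)"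
    and smooth_with_avg_fun: "smooth_with L (avg_fun n f)"
proof -
  have GDERIV: "GDERIV (avg_fun n f) x :> (1 / real n) *\<^sub>R (\<Sum>i=1..n. grad (f i) x)" for x
  proof -
    have "(f i has_derivative (\<lambda>h. h \<bullet> grad (f i) x)) (at x)" if "i \<in> {1..n}" for i
      using GDERIV_grad smooth[OF that] by (auto simp: smooth_with_def gderiv_def)
    then have "((\<lambda>x. (1 / real n) * (\<Sum>i=1..n. f i x)) has_derivative
        (\<lambda>h. (1 / real n) * (\<Sum>i=1..n. h \<bullet> grad (f i) x))) (at x)"
      by (intro has_derivative_mult_right has_derivative_sum)
    then show ?thesis
      by (simp add: gderiv_def avg_fun_def[abs_def] inner_sum_right)
  qed
  then show grad: "grad (avg_fun n f) x = (1 / real n) *\<^sub>R (\<Sum>i=1..n. grad (f i) x)" for x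
    by (rule grad_eqI)
  have "avg_fun n f differentiable (at x)" for x
    using GDERIV by (auto simp: gderiv_def differentiable_def)
  moreover have "norm (grad (avg_fun n f) x - grad (avg_fun n f) y) \<le> L * norm (x - y)" for x y
  proof -
    have "(\<Sum>i=1..n. Li i)\<^sup>2 \<le> (\<Sum>i=1..n. (Li i)\<^sup>2) * real n"
      using Cauchy_Schwarz_ineq_sum[of Li "\<lambda>_. 1" "{1..n}"] by simp
    \<comment> \<open>For \<open>n = 0\<close> both sides vanish because
      \<open>1 / 0 = 0\<close>.\<close>
    then have "((1 / real n) * (\<Sum>i=1..n. Li i))\<^sup>2 \<le> L\<^sup>2"
      unfolding L(2) by (cases "n = 0") (simp_all add: power_divide divide_simps power2_eq_square)
    then have mean: "(1 / real n) * (\<Sum>i=1..n. Li i) \<le> L"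
      using L(1) power2_le_imp_le by blast
    have "norm (grad (avg_fun n f) x - grad (avg_fun n f) y)
        = (1 / real n) * norm (\<Sum>i=1..n. grad (f i) x - grad (f i) y)"
      by (simp add: grad scaleR_diff_right[symmetric] sum_subtractf)
    also have "\<dots> \<le> (1 / real n) * (\<Sum>i=1..n. Li i * norm (x - y))"
      using smooth by (intro mult_left_mono sum_norm_le) (auto simp: smooth_with_def)
    also have "\<dots> = ((1 / real n) * (\<Sum>i=1..n. Li i)) * norm (x - y)"
      by (simp add: sum_distrib_right)
    also have "\<dots> \<le> L * norm (x - y)"
      using mean by (rule mult_right_mono) simp
    finally show ?thesis .
  qed
  ultimately show "smooth_with L (avg_fun n f)"
    by (simp add: smooth_with_def)
qed

text \<open>A negative constant contradicts the inequality at two distinct points, so the space is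
  then a single point and continuity is trivial.\<close>

lemma smooth_with_continuous_grad:
  assumes "smooth_with L F"
  shows "continuous_on UNIV (grad F)"
proof (cases "L \<ge> 0")
  case True
  with assms have "L-lipschitz_on UNIV (grad F)"
    by (intro lipschitz_onI) (auto simp: smooth_with_def dist_norm)
  then show ?thesis
    by (rule lipschitz_on_continuous_on)
next
  case False
  have "x = y" for x y :: 'a
  proof (rule ccontr)
    assume "x \<noteq> y"
    with False have "L * norm (x - y) < 0"
      by (simp add: mult_neg_pos)
    moreover have "norm (grad F x - grad F y) \<le> L * norm (x - y)"
      using assms by (simp add: smooth_with_def)
    ultimately show False
      using norm_ge_zero[of "grad F x - grad F y"] by linarith
  qed
  then have "grad F = (\<lambda>_. grad F 0)"
    by metis
  then show ?thesis
    by (metis continuous_on_const)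
qed

lemma smooth_with_measurable_grad [measurable]:
  fixes F :: "'a::euclidean_space \<Rightarrow> real"
  assumes "smooth_with L F"
  shows "grad F \<in> borel_measurable borel"
  using smooth_with_continuous_grad[OF assms] by (rule borel_measurable_continuous_onI)

section \<open>Quantization operators\<close>

text \<open>Expanding the square, unbiasedness removes the cross term. The free offset
  \<open>b\<close> will hold the previous error and the contributions of other workers.\<close>

lemma quantization_nn_variance:
  fixes Q :: "'s \<Rightarrow> real ^ 'd \<Rightarrow> real ^ 'd"
  assumes "quantization S Q \<omega>"
  shows "(\<integral>\<^sup>+s. ennreal ((norm (b + c *\<^sub>R (Q s v - v)))\<^sup>2) \<partial>S)
    \<le> ennreal ((norm b)\<^sup>2 + c\<^sup>2 * \<omega> * (norm v)\<^sup>2)"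
proof -
  interpret prob_space S
    using assms by (simp add: quantization_def)
  have int [simp]: "integrable S (\<lambda>s. Q s v)" "integrable S (\<lambda>s. (norm (Q s v - v))\<^sup>2)"
    and mean: "(\<integral>s. Q s v \<partial>S) = v"
    and var: "(\<integral>s. (norm (Q s v - v))\<^sup>2 \<partial>S) \<le> \<omega> * (norm v)\<^sup>2"
    using assms by (auto simp: quantization_def)
  have eq: "(norm (b + c *\<^sub>R (Q s v - v)))\<^sup>2
      = (norm b)\<^sup>2 + 2 * c * (b \<bullet> (Q s v - v)) + c\<^sup>2 * (norm (Q s v - v))\<^sup>2" for s
    unfolding power2_norm_eq_inner inner_add_left inner_add_right inner_scaleR_left
      inner_scaleR_right inner_commute[of "Q s v - v" b]
    by (simp only: power2_eq_square) algebra
  have 0: "(\<integral>s. b \<bullet> (Q s v - v) \<partial>S) = 0"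
    by (simp add: mean prob_space)
  have "(\<integral>\<^sup>+s. ennreal ((norm (b + c *\<^sub>R (Q s v - v)))\<^sup>2) \<partial>S)
      = ennreal (\<integral>s. (norm (b + c *\<^sub>R (Q s v - v)))\<^sup>2 \<partial>S)"
  proof (rule nn_integral_eq_integral)
    show "integrable S (\<lambda>s. (norm (b + c *\<^sub>R (Q s v - v)))\<^sup>2)"
      unfolding eq by auto
  qed auto
  also have "(\<integral>s. (norm (b + c *\<^sub>R (Q s v - v)))\<^sup>2 \<partial>S)
      = (norm b)\<^sup>2 + c\<^sup>2 * (\<integral>s. (norm (Q s v - v))\<^sup>2 \<partial>S)"
    unfolding eq using 0 by (simp add: prob_space)
  also have "\<dots> \<le> (norm b)\<^sup>2 + c\<^sup>2 * \<omega> * (norm v)\<^sup>2"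
    using mult_left_mono[OF var, of "c\<^sup>2"] by (simp add: mult.assoc)
  finally show ?thesis
    by (simp add: ennreal_leI)
qed

lemma quantization_measurable:
  assumes "quantization S Q \<omega>" "g \<in> measurable M S" "h \<in> borel_measurable M"
  shows "(\<lambda>x. Q (g x) (h x)) \<in> borel_measurable M"
proof -
  have "(\<lambda>(s, v). Q s v) \<in> borel_measurable (S \<Otimes>\<^sub>M borel)"
    using assms(1) by (simp add: quantization_def)
  from measurable_compose[OF measurable_Pair[OF assms(2,3)] this] show ?thesis
    by simp
qed

text \<open>Peeling off one worker at a time turns the independence of the seeds into Fubini's theorem,
  so that no cross terms have to be shown integrable.\<close>
lemma quantization_sum_nn_variance:
  fixes Q :: "'s \<Rightarrow> real ^ 'd \<Rightarrow> real ^ 'd"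
  assumes Q: "quantization S Q \<omega>" and "finite I"
  shows "(\<integral>\<^sup>+s. ennreal ((norm (b + c *\<^sub>R (\<Sum>i\<in>I. Q (s i) (v i) - v i)))\<^sup>2) \<partial>(\<Pi>\<^sub>M i\<in>I. S))
    \<le> ennreal ((norm b)\<^sup>2 + c\<^sup>2 * \<omega> * (\<Sum>i\<in>I. (norm (v i))\<^sup>2))"
  using \<open>finite I\<close>
proof (induction I arbitrary: b)
  case empty
  interpret prob_space "\<Pi>\<^sub>M i\<in>{}. S"
    using Q by (intro prob_space_PiM) (simp add: quantization_def)
  show ?case
    by (simp add: emeasure_space_1 del: space_PiM_empty)
next
  case (insert j I)
  interpret prob_space S
    using Q by (simp add: quantization_def)
  interpret product_sigma_finite "\<lambda>_. S" ..
  have \<omega>: "\<omega> \<ge> 0"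
    using Q by (simp add: quantization_def)
  let ?Z = "\<lambda>s. b + c *\<^sub>R (\<Sum>i\<in>I. Q (s i) (v i) - v i)"
  have [measurable]: "(\<lambda>s. Q (s i) (v i)) \<in> borel_measurable (\<Pi>\<^sub>M i\<in>J. S)" if "i \<in> J" for i J
    using that by (intro quantization_measurable[OF Q]) auto
  interpret I: prob_space "\<Pi>\<^sub>M i\<in>I. S"
    by (intro prob_space_PiM) (rule prob_space_axioms)
  have "(\<integral>\<^sup>+s. ennreal ((norm (b + c *\<^sub>R (\<Sum>i\<in>insert j I. Q (s i) (v i) - v i)))\<^sup>2)
        \<partial>(\<Pi>\<^sub>M i\<in>insert j I. S))
      = (\<integral>\<^sup>+s. (\<integral>\<^sup>+y. ennreal ((norm (b + c *\<^sub>R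
          (\<Sum>i\<in>insert j I. Q ((s(j := y)) i) (v i) - v i)))\<^sup>2) \<partial>S) \<partial>(\<Pi>\<^sub>M i\<in>I. S))"
    using insert.hyps by (intro product_nn_integral_insert) measurable
  also have "\<dots> = (\<integral>\<^sup>+s. (\<integral>\<^sup>+y. ennreal ((norm (?Z s + c *\<^sub>R (Q y (v j) - v j)))\<^sup>2) \<partial>S)
      \<partial>(\<Pi>\<^sub>M i\<in>I. S))"
  proof -
    have "(\<Sum>i\<in>I. Q ((s(j := y)) i) (v i) - v i) = (\<Sum>i\<in>I. Q (s i) (v i) - v i)" for s y
      using insert.hyps by (intro sum.cong) auto
    then show ?thesis
      using insert.hyps by (simp add: algebra_simps)
  qed
  \<comment> \<open>\<open>?Z s\<close> does not depend on the seed of \<open>j\<close>, so it can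
    serve as the offset in the bound for one worker.\<close>
  also have "\<dots> \<le> (\<integral>\<^sup>+s. ennreal ((norm (?Z s))\<^sup>2 + c\<^sup>2 * \<omega> * (norm (v j))\<^sup>2) \<partial>(\<Pi>\<^sub>M i\<in>I. S))"
    by (intro nn_integral_mono quantization_nn_variance[OF Q])
  also have "\<dots> = (\<integral>\<^sup>+s. ennreal ((norm (?Z s))\<^sup>2) \<partial>(\<Pi>\<^sub>M i\<in>I. S))
      + ennreal (c\<^sup>2 * \<omega> * (norm (v j))\<^sup>2)"
    using \<omega> by (simp add: nn_integral_add I.emeasure_space_1)
  also have "\<dots> \<le> ennreal ((norm b)\<^sup>2 + c\<^sup>2 * \<omega> * (\<Sum>i\<in>I. (norm (v i))\<^sup>2))
      + ennreal (c\<^sup>2 * \<omega> * (norm (v j))\<^sup>2)"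
    by (intro add_right_mono insert.IH)
  also have "\<dots> = ennreal ((norm b)\<^sup>2 + c\<^sup>2 * \<omega> * (\<Sum>i\<in>insert j I. (norm (v i))\<^sup>2))"
    using insert.hyps \<omega> by (simp add: sum_nonneg algebra_simps flip: ennreal_plus)
  finally show ?case .
qed

lemma nnz_le_CARD: "nnz (y :: real ^ 'd) \<le> CARD('d)"
  unfolding nnz_def by (rule card_mono) auto

text \<open>\<open>nnz\<close> is a finite sum of indicators of the open sets
  \<open>{y. y $ j \<noteq> 0}\<close>.\<close>

lemma nnz_measurable [measurable]: "(\<lambda>y :: real ^ 'd. real (nnz y)) \<in> borel_measurable borel"
proof -
  have "real (nnz y) = (\<Sum>j\<in>UNIV. indicator {y. y $ j \<noteq> 0} y)" for y :: "real ^ 'd"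
    by (simp add: nnz_def indicator_def sum.If_cases)
  moreover have "{y :: real ^ 'd. y $ j \<noteq> 0} \<in> sets borel" for j
    by (intro borel_open open_Collect_neq continuous_intros)
  ultimately show ?thesis
    by (simp add: borel_measurable_sum)
qed

lemma density_at_nonneg: "0 \<le> density_at S Q v"
  by (simp add: density_at_def)

context
  fixes S :: "'s measure" and Q :: "'s \<Rightarrow> real ^ 'd \<Rightarrow> real ^ 'd" and \<omega> :: real
  assumes Q: "quantization S Q \<omega>"
begin

interpretation prob_space S
  using Q by (simp add: quantization_def)

lemma integrable_nnz_quantization: "integrable S (\<lambda>s. real (nnz (Q s v)))"
proof (rule integrable_const_bound[where B = "real CARD('d)"])
  have [measurable]: "(\<lambda>s. Q s v) \<in> borel_measurable S"
    by (rule quantization_measurable[OF Q]) auto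
  show "(\<lambda>s. real (nnz (Q s v))) \<in> borel_measurable S"
    by measurable
qed (auto simp: nnz_le_CARD)

text \<open>Bounds the family from above, so that the real-valued \<open>SUP\<close> in
  \<open>expected_density\<close> is a true supremum.\<close>

lemma density_at_le_CARD: "density_at S Q v \<le> real CARD('d)"
proof -
  have "density_at S Q v \<le> (\<integral>s. real CARD('d) \<partial>S)"
    unfolding density_at_def
    by (rule integral_mono) (auto simp: nnz_le_CARD integrable_nnz_quantization)
  then show ?thesis
    by (simp add: prob_space)
qed

lemma density_at_le_expected_density: "density_at S Q v \<le> expected_density S Q"
  unfolding expected_density_def
  by (rule cSUP_upper) (auto intro!: bdd_aboveI2 density_at_le_CARD)

lemma expected_density_nonneg: "0 \<le> expected_density S Q"
  using density_at_nonneg density_at_le_expected_density order_trans by blast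

lemma expected_density_le_CARD: "expected_density S Q \<le> real CARD('d)"
  unfolding expected_density_def by (rule cSUP_least) (auto simp: density_at_le_CARD)

end

section \<open>The run of MARINA\<close>

text \<open>The stepsize bound is multiplied out: as a quotient it would read
  \<open>\<gamma> \<le> 1 / 0 = 0\<close> for \<open>L = 0\<close>.\<close>

locale marina_setting =
  fixes f :: "nat \<Rightarrow> real ^ 'd \<Rightarrow> real"
    and Li :: "nat \<Rightarrow> real"
    and S :: "'s measure"
    and Q :: "'s \<Rightarrow> real ^ 'd \<Rightarrow> real ^ 'd"
    and n :: nat
    and L p \<gamma> \<omega> fstar :: real
    and x0 :: "real ^ 'd"
  assumes n: "n \<ge> 1"
    and lower_bound: "avg_fun n f x \<ge> fstar"
    and smooth: "i \<in> {1..n} \<Longrightarrow> smooth_with (Li i) (f i)"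
    and quant: "quantization S Q \<omega>"
    and p: "0 < p" "p \<le> 1"
    and L: "L \<ge> 0" "L\<^sup>2 = (1 / real n) * (\<Sum>i=1..n. (Li i)\<^sup>2)"
    and \<gamma>_pos: "\<gamma> > 0"
    and \<gamma>_le: "\<gamma> * L * (1 + sqrt ((1 - p) * \<omega> / (p * real n))) \<le> 1"
begin

\<comment> \<open>Otherwise simp rewrites \<open>{1..n}\<close> to \<open>{Suc 0..n}\<close>, which then no longer matches the index
  set of the product measure.\<close>
declare One_nat_def [simp del]

abbreviation "F \<equiv> avg_fun n f"
abbreviation "draw \<equiv> measure_pmf (bernoulli_pmf p) \<Otimes>\<^sub>M (\<Pi>\<^sub>M i\<in>{1..n}. S)"
abbreviation "state \<equiv> marina n f Q \<gamma> x0"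
abbreviation "iterate \<equiv> marina_x n f Q \<gamma> x0"

lemma grad_F: "grad F x = (1 / real n) *\<^sub>R (\<Sum>i=1..n. grad (f i) x)"
  by (rule grad_avg_fun[OF smooth L])

lemma smooth_F: "smooth_with L F"
  by (rule smooth_with_avg_fun[OF smooth L])

lemma \<omega>_pos: "\<omega> > 0"
  using quant by (simp add: quantization_def)

sublocale S: prob_space S
  using quant by (simp add: quantization_def)

sublocale seeds: prob_space "\<Pi>\<^sub>M i\<in>{1..n}. S"
  by (intro prob_space_PiM) (rule S.prob_space_axioms)

sublocale draw: prob_space draw
proof -
  interpret pair_prob_space "measure_pmf (bernoulli_pmf p)" "\<Pi>\<^sub>M i\<in>{1..n}. S" ..
  show "prob_space draw" by (rule prob_space_axioms)
qed

sublocale run: prob_space "run_space p n S"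
  unfolding run_space_def by (intro prob_space_PiM) (rule draw.prob_space_axioms)

section \<open>Integration over a single draw, and the law of one coordinate of the run\<close>

lemma nn_integral_draw:
  assumes "h \<in> borel_measurable draw"
  shows "(\<integral>\<^sup>+cs. h cs \<partial>draw)
    = ennreal p * (\<integral>\<^sup>+s. h (True, s) \<partial>(\<Pi>\<^sub>M i\<in>{1..n}. S))
      + ennreal (1 - p) * (\<integral>\<^sup>+s. h (False, s) \<partial>(\<Pi>\<^sub>M i\<in>{1..n}. S))"
  using p unfolding seeds.nn_integral_fst[OF assms, symmetric] by (simp add: mult.commute)

text \<open>The marginals of a product of probability measures are its factors. This serves the
  message of one worker, which reads no other seed.\<close>

lemma nn_integral_seed:
  assumes "i \<in> {1..n}" "h \<in> borel_measurable S"
  shows "(\<integral>\<^sup>+s. h (s i) \<partial>(\<Pi>\<^sub>M i\<in>{1..n}. S)) = (\<integral>\<^sup>+s. h s \<partial>S)"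
proof -
  have "distr (\<Pi>\<^sub>M i\<in>{1..n}. S) S (\<lambda>s. s i) = S"
    using assms(1) by (intro distr_PiM_component S.prob_space_axioms)
  then have "(\<integral>\<^sup>+s. h s \<partial>S) = (\<integral>\<^sup>+s. h s \<partial>distr (\<Pi>\<^sub>M i\<in>{1..n}. S) S (\<lambda>s. s i))"
    by simp
  also have "\<dots> = (\<integral>\<^sup>+s. h (s i) \<partial>(\<Pi>\<^sub>M i\<in>{1..n}. S))"
    using assms by (intro nn_integral_distr) auto
  finally show ?thesis ..
qed

lemma distr_run_component: "distr (run_space p n S) draw (\<lambda>r. r k) = draw"
  unfolding run_space_def by (intro distr_PiM_component draw.prob_space_axioms) simp

lemma measurable_run_component [measurable]: "(\<lambda>r. r k) \<in> measurable (run_space p n S) draw"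
  unfolding run_space_def by measurable

section \<open>Measurability of messages and states\<close>

lemma grad_f_measurable:
  "i \<in> {1..n} \<Longrightarrow> h \<in> borel_measurable M \<Longrightarrow> (\<lambda>x. grad (f i) (h x)) \<in> borel_measurable M"
  using smooth_with_measurable_grad[OF smooth] by (rule measurable_compose[rotated])

lemma grad_F_measurable [measurable]: "grad F \<in> borel_measurable borel"
  by (rule smooth_with_measurable_grad[OF smooth_F])

lemma F_measurable [measurable]: "F \<in> borel_measurable borel"
proof -
  have "F differentiable (at x)" for x
    using smooth_F by (simp add: smooth_with_def)
  then show ?thesis
    by (intro borel_measurable_continuous_onI continuous_at_imp_continuous_on)
      (auto intro: differentiable_imp_continuous_within)
qed

lemma coin_measurable:
  assumes [measurable]: "cs \<in> measurable M draw"
  shows "Measurable.pred M (\<lambda>x. fst (cs x))"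
proof -
  have "(\<lambda>x. fst (cs x)) \<in> measurable M (measure_pmf (bernoulli_pmf p))"
    by measurable
  then show ?thesis
    by (simp add: measurable_cong_sets[OF refl sets_measure_pmf_count_space])
qed

lemma msg_measurable:
  assumes i: "i \<in> {1..n}"
    and [measurable]: "cs \<in> measurable M draw" "x \<in> borel_measurable M" "x' \<in> borel_measurable M"
  shows "(\<lambda>z. marina_msg Q f (cs z) i (x z) (x' z)) \<in> borel_measurable M"
proof -
  note [measurable] = coin_measurable[OF assms(2)] grad_f_measurable[OF i]
  have [measurable]: "(\<lambda>z. snd (cs z) i) \<in> measurable M S"
    using i by measurable
  have [measurable]: "(\<lambda>z. Q (snd (cs z) i) (grad (f i) (x' z) - grad (f i) (x z)))
      \<in> borel_measurable M"
    by (rule quantization_measurable[OF quant]) measurable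
  show ?thesis
    unfolding marina_msg_def by measurable
qed

text \<open>The transition map of the Markov chain \<open>(x^k, g^k)\<close>. With draw and state as
  separate arguments, the draw can be integrated while the state is held fixed.\<close>

definition marina_step ::
    "bool \<times> (nat \<Rightarrow> 's) \<Rightarrow> (real ^ 'd) \<times> (real ^ 'd) \<Rightarrow> (real ^ 'd) \<times> (real ^ 'd)" where
  "marina_step cs st =
     (let x' = fst st - \<gamma> *\<^sub>R snd st
      in (x', (1 / real n) *\<^sub>R (\<Sum>i=1..n.
            (if fst cs then 0 else snd st) + marina_msg Q f cs i (fst st) x')))"

lemma marina_step_measurable [measurable (raw)]:
  assumes [measurable]: "cs \<in> measurable M draw" "st \<in> measurable M (borel \<Otimes>\<^sub>M borel)"
  shows "(\<lambda>z. marina_step (cs z) (st z)) \<in> measurable M (borel \<Otimes>\<^sub>M borel)"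
proof -
  note [measurable] = coin_measurable[OF assms(1)]
  have [measurable]: "(\<lambda>z. marina_msg Q f (cs z) i (fst (st z)) (fst (st z) - \<gamma> *\<^sub>R snd (st z)))
      \<in> borel_measurable M" if "i \<in> {1..n}" for i
    using that by (intro msg_measurable) measurable
  show ?thesis
    unfolding marina_step_def Let_def by measurable
qed

lemma state_Suc: "state r (Suc k) = marina_step (r k) (state r k)"
  by (simp add: marina_step_def Let_def split_beta)

text \<open>The index set is kept general for two uses: \<open>UNIV\<close> for the whole run and
  \<open>{..<k}\<close> for the past alone.\<close>

lemma state_measurable:
  "{..<k} \<subseteq> I \<Longrightarrow> (\<lambda>r. state r k) \<in> measurable (\<Pi>\<^sub>M k\<in>I. draw) (borel \<Otimes>\<^sub>M borel)"
proof (induction k)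
  case (Suc k)
  then have "{..<k} \<subseteq> I"
    by auto
  note [measurable] = Suc.IH[OF this]
  have "k \<in> I"
    using Suc.prems by auto
  then have [measurable]: "(\<lambda>r. r k) \<in> measurable (\<Pi>\<^sub>M k\<in>I. draw) draw"
    by measurable
  show ?case
    unfolding state_Suc by measurable
qed simp

lemma state_run_measurable [measurable]:
  "(\<lambda>r. state r k) \<in> measurable (run_space p n S) (borel \<Otimes>\<^sub>M borel)"
  unfolding run_space_def by (rule state_measurable) simp

lemma iterate_measurable [measurable]: "(\<lambda>r. iterate r k) \<in> borel_measurable (run_space p n S)"
  unfolding marina_x_def by measurable

section \<open>Independence of the past and the current draw\<close>

lemma state_restrict: "{..<k} \<subseteq> I \<Longrightarrow> state (restrict r I) k = state r k"
proof (induction k)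
  case (Suc k)
  then have "{..<k} \<subseteq> I" "k \<in> I"
    by auto
  with Suc.IH show ?case
    by (simp only: state_Suc restrict_apply')
qed simp

text \<open>The coordinates of a product of probability measures are independent, hence so are the
  blocks over the disjoint index sets \<open>{..<k}\<close> and \<open>{k}\<close>.\<close>

lemma indep_past_present:
  "run.indep_var (\<Pi>\<^sub>M j\<in>{..<k}. draw) (\<lambda>r. restrict r {..<k})
    (\<Pi>\<^sub>M j\<in>{k}. draw) (\<lambda>r. restrict r {k})"
proof -
  have "run.indep_vars (\<lambda>_. draw) (\<lambda>k r. r k) UNIV"
  proof (subst run.indep_vars_iff_distr_eq_PiM)
    show "distr (run_space p n S) (\<Pi>\<^sub>M i\<in>UNIV. draw) (\<lambda>r. \<lambda>i\<in>UNIV. r i)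
        = (\<Pi>\<^sub>M i\<in>UNIV. distr (run_space p n S) draw (\<lambda>r. r i))"
      unfolding distr_run_component unfolding restrict_UNIV run_space_def by (rule distr_id2) simp
  qed auto
  then show ?thesis
    by (rule run.indep_var_restrict) auto
qed

text \<open>The Markov property: the state reads only draws before \<open>k\<close>, the draw
  \<open>r k\<close> is independent of them with law \<open>draw\<close>, and Fubini separates the
  two.\<close>

lemma nn_integral_state_draw:
  assumes h [measurable]: "h \<in> borel_measurable ((borel \<Otimes>\<^sub>M borel) \<Otimes>\<^sub>M draw)"
  shows "(\<integral>\<^sup>+r. h (state r k, r k) \<partial>run_space p n S)
    = (\<integral>\<^sup>+r. (\<integral>\<^sup>+cs. h (state r k, cs) \<partial>draw) \<partial>run_space p n S)"
proof -
  let ?R = "run_space p n S"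
  let ?A = "\<Pi>\<^sub>M j\<in>{..<k}. draw" and ?B = "\<Pi>\<^sub>M j\<in>{k}. draw"
  let ?X = "\<lambda>r :: nat \<Rightarrow> bool \<times> (nat \<Rightarrow> 's). restrict r {..<k}"
  let ?Y = "\<lambda>r :: nat \<Rightarrow> bool \<times> (nat \<Rightarrow> 's). restrict r {k}"
  have X [measurable]: "?X \<in> measurable ?R ?A" and Y [measurable]: "?Y \<in> measurable ?R ?B"
    and joint: "distr ?R ?A ?X \<Otimes>\<^sub>M distr ?R ?B ?Y = distr ?R (?A \<Otimes>\<^sub>M ?B) (\<lambda>r. (?X r, ?Y r))"
    using indep_past_present[of k] by (simp_all add: run.indep_var_distribution_eq)
  have state [measurable]: "(\<lambda>u. state u k) \<in> measurable ?A (borel \<Otimes>\<^sub>M borel)"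
    by (rule state_measurable) simp
  have [measurable]: "(\<lambda>w. w k) \<in> measurable ?B draw"
    by measurable
  interpret Y: prob_space "distr ?R ?B ?Y"
    by (rule run.prob_space_distr) measurable
  \<comment> \<open>Passing to the two restrictions writes the integrand as a function of the
    independent blocks, whose joint law factors by \<open>joint\<close>.\<close>
  have "(\<integral>\<^sup>+r. h (state r k, r k) \<partial>?R) = (\<integral>\<^sup>+r. h (state (?X r) k, ?Y r k) \<partial>?R)"
    by (simp add: state_restrict)
  also have "\<dots> = (\<integral>\<^sup>+z. h (state (fst z) k, snd z k) \<partial>distr ?R (?A \<Otimes>\<^sub>M ?B) (\<lambda>r. (?X r, ?Y r)))"
    by (subst nn_integral_distr) auto
  also have "\<dots> = (\<integral>\<^sup>+z. h (state (fst z) k, snd z k) \<partial>(distr ?R ?A ?X \<Otimes>\<^sub>M distr ?R ?B ?Y))"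
    by (simp only: joint)
  also have "\<dots> = (\<integral>\<^sup>+u. (\<integral>\<^sup>+w. h (state u k, w k) \<partial>distr ?R ?B ?Y) \<partial>distr ?R ?A ?X)"
    by (subst Y.nn_integral_fst[symmetric]) auto
  also have "\<dots> = (\<integral>\<^sup>+r. (\<integral>\<^sup>+w. h (state r k, w k) \<partial>distr ?R ?B ?Y) \<partial>?R)"
    by (subst nn_integral_distr) (auto simp: state_restrict)
  also have "\<dots> = (\<integral>\<^sup>+r. (\<integral>\<^sup>+cs. h (state r k, cs) \<partial>draw) \<partial>?R)"
  proof (rule nn_integral_cong)
    fix r
    have [measurable]: "(\<lambda>cs. h (state r k, cs)) \<in> borel_measurable draw"
      by (rule measurable_compose[OF measurable_Pair1' h]) (simp add: space_pair_measure)
    have "(\<integral>\<^sup>+w. h (state r k, w k) \<partial>distr ?R ?B ?Y) = (\<integral>\<^sup>+r'. h (state r k, r' k) \<partial>?R)"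
      by (subst nn_integral_distr) auto
    also have "\<dots> = (\<integral>\<^sup>+cs. h (state r k, cs) \<partial>distr ?R draw (\<lambda>r. r k))"
      by (rule nn_integral_distr[symmetric]) auto
    finally show "(\<integral>\<^sup>+w. h (state r k, w k) \<partial>distr ?R ?B ?Y) = (\<integral>\<^sup>+cs. h (state r k, cs) \<partial>draw)"
      by (simp only: distr_run_component)
  qed
  finally show ?thesis .
qed

subsection \<open>Convergence\<close>

text \<open>The weight \<open>\<gamma> / (2 * p)\<close> is chosen so that its expected loss through
  the coin, a fraction \<open>p\<close>, is exactly the \<open>\<gamma> / 2\<close> with which the
  error enters the descent inequality.\<close>

definition lyapunov :: "(real ^ 'd) \<times> (real ^ 'd) \<Rightarrow> real" where
  "lyapunov st = F (fst st) - fstar + \<gamma> / (2 * p) * (norm (snd st - grad F (fst st)))\<^sup>2"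

lemma lyapunov_measurable [measurable]: "lyapunov \<in> borel_measurable (borel \<Otimes>\<^sub>M borel)"
  unfolding lyapunov_def by measurable

text \<open>The next point \<open>x'\<close> is fixed before the draw, so only the error is random.
  It is zero if the coin shows \<open>True\<close>; otherwise it is the old error plus a mean of
  centred quantization errors.\<close>

lemma nn_integral_lyapunov_step_le:
  fixes x g :: "real ^ 'd"
  defines "x' \<equiv> x - \<gamma> *\<^sub>R g"
  shows "(\<integral>\<^sup>+cs. ennreal (lyapunov (marina_step cs (x, g))) \<partial>draw)
    \<le> ennreal (F x' - fstar + (1 - p) * (\<gamma> / (2 * p))
        * ((norm (g - grad F x))\<^sup>2 + \<omega> * L\<^sup>2 / real n * (norm (x' - x))\<^sup>2))"
proof -
  let ?seeds = "\<Pi>\<^sub>M i\<in>{1..n}. S"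
  define d where "d i = grad (f i) x' - grad (f i) x" for i
  define a where "a = F x' - fstar"
  define b where "b = \<gamma> / (2 * p)"
  define V where "V = (norm (g - grad F x))\<^sup>2 + \<omega> * L\<^sup>2 / real n * (norm (x' - x))\<^sup>2"
  have nonneg: "a \<ge> 0" "b \<ge> 0" "V \<ge> 0"
    using lower_bound \<gamma>_pos p \<omega>_pos by (simp_all add: a_def b_def V_def)
  have True: "lyapunov (marina_step (True, s) (x, g)) = a" for s
    by (simp add: lyapunov_def marina_step_def marina_msg_def a_def x'_def grad_F Let_def)
  have False: "lyapunov (marina_step (False, s) (x, g)) = a + b * (norm (g - grad F x
      + (1 / real n) *\<^sub>R (\<Sum>i=1..n. Q (s i) (d i) - d i)))\<^sup>2" for s
  \<comment> \<open>The mean of the \<open>d i\<close> is \<open>grad F x' - grad F x\<close>, so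
    subtracting \<open>grad F x'\<close> leaves the old error and centres each quantized
    difference.\<close>
  proof -
    have "snd (marina_step (False, s) (x, g)) = g + (1 / real n) *\<^sub>R (\<Sum>i=1..n. Q (s i) (d i))"
      using n by (simp add: marina_step_def marina_msg_def x'_def d_def sum.distrib Let_def
          scaleR_add_right sum_constant_scaleR del: sum_constant)
    moreover have "grad F x' = grad F x + (1 / real n) *\<^sub>R (\<Sum>i=1..n. d i)"
      by (simp add: grad_F d_def sum_subtractf scaleR_diff_right)
    ultimately have "snd (marina_step (False, s) (x, g)) - grad F x'
        = g - grad F x + (1 / real n) *\<^sub>R (\<Sum>i=1..n. Q (s i) (d i) - d i)"
      by (simp add: sum_subtractf scaleR_diff_right)
    moreover have "fst (marina_step (False, s) (x, g)) = x'"
      by (simp add: marina_step_def x'_def Let_def)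
    ultimately show ?thesis
      by (simp add: lyapunov_def a_def b_def)
  qed
  have [measurable]: "(\<lambda>s. Q (s i) (d i)) \<in> borel_measurable ?seeds" if "i \<in> {1..n}" for i
    using that by (intro quantization_measurable[OF quant]) auto
  \<comment> \<open>Squared Lipschitz bounds add up to \<open>n\<close> times
    \<open>L\<^sup>2\<close>. Against the factor \<open>(1 / n)\<^sup>2\<close> from averaging, this
    leaves the variance reduction by \<open>1 / n\<close>.\<close>
  have "(\<Sum>i=1..n. (norm (d i))\<^sup>2) \<le> (\<Sum>i=1..n. (Li i * norm (x' - x))\<^sup>2)"
    using smooth by (intro sum_mono power_mono) (auto simp: smooth_with_def d_def)
  also have "\<dots> = real n * L\<^sup>2 * (norm (x' - x))\<^sup>2"
    using n by (simp add: L(2) power_mult_distrib sum_distrib_right)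
  finally have "(1 / real n)\<^sup>2 * \<omega> * (\<Sum>i=1..n. (norm (d i))\<^sup>2)
      \<le> (1 / real n)\<^sup>2 * \<omega> * (real n * L\<^sup>2 * (norm (x' - x))\<^sup>2)"
    using \<omega>_pos by (intro mult_left_mono) auto
  also have "\<dots> = \<omega> * L\<^sup>2 / real n * (norm (x' - x))\<^sup>2"
    using n by (simp add: power2_eq_square)
  finally have "(\<integral>\<^sup>+s. ennreal ((norm (g - grad F x
        + (1 / real n) *\<^sub>R (\<Sum>i=1..n. Q (s i) (d i) - d i)))\<^sup>2) \<partial>?seeds) \<le> ennreal V"
    using quantization_sum_nn_variance[OF quant, of "{1..n}" "g - grad F x" "1 / real n" d]
    by (auto simp: V_def elim!: order_trans intro!: ennreal_leI)
  then have "(\<integral>\<^sup>+s. ennreal (lyapunov (marina_step (False, s) (x, g))) \<partial>?seeds)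
      \<le> ennreal a + ennreal b * ennreal V"
    unfolding False using nonneg
    by (simp add: nn_integral_add nn_integral_cmult ennreal_mult seeds.emeasure_space_1
        mult_left_mono)
  then have "(\<integral>\<^sup>+cs. ennreal (lyapunov (marina_step cs (x, g))) \<partial>draw)
      \<le> ennreal p * ennreal a + ennreal (1 - p) * (ennreal a + ennreal b * ennreal V)"
    by (subst nn_integral_draw)
      (auto simp: True seeds.emeasure_space_1 intro!: mult_left_mono)
  also have "\<dots> = ennreal (p * a + (1 - p) * (a + b * V))"
    using nonneg p by (simp flip: ennreal_plus ennreal_mult)
  also have "p * a + (1 - p) * (a + b * V) = a + (1 - p) * b * V"
    by (simp add: algebra_simps)
  finally show ?thesis
    by (simp only: a_def b_def V_def)
qed

text \<open>With \<open>t = \<gamma> * L\<close> and \<open>s\<close> the square root, the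
  hypothesis reads \<open>t * s \<le> 1 - t\<close>. Squaring and
  \<open>0 \<le> 1 - t \<le> 1\<close> give \<open>(t * s)\<^sup>2 \<le> 1 - t\<close>.\<close>

lemma stepsize: "(\<gamma> * L)\<^sup>2 * ((1 - p) * \<omega> / (p * real n)) + \<gamma> * L \<le> 1"
proof -
  define t where "t = \<gamma> * L"
  define s where "s = sqrt ((1 - p) * \<omega> / (p * real n))"
  have "s \<ge> 0" "t \<ge> 0" and s2: "s\<^sup>2 = (1 - p) * \<omega> / (p * real n)"
    using p \<omega>_pos L(1) \<gamma>_pos by (simp_all add: s_def t_def)
  moreover have ts: "t * s \<le> 1 - t"
    using \<gamma>_le by (simp add: t_def s_def algebra_simps)
  ultimately have "0 \<le> 1 - t" "1 - t \<le> 1"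
    using mult_nonneg_nonneg[of t s] by linarith+
  have "(t * s)\<^sup>2 \<le> (1 - t)\<^sup>2"
    using ts \<open>s \<ge> 0\<close> \<open>t \<ge> 0\<close> by (intro power_mono) auto
  also have "\<dots> \<le> 1 - t"
    using \<open>0 \<le> 1 - t\<close> \<open>1 - t \<le> 1\<close> by (simp add: power2_eq_square mult_left_le)
  finally show ?thesis
    by (simp add: power_mult_distrib flip: s2 t_def)
qed

text \<open>In the descent inequality the error terms \<open>E\<close> cancel and the terms in
  \<open>N\<close> are nonpositive by \<open>stepsize\<close>. The gradient term is added on the
  left to avoid truncated subtraction in \<open>ennreal\<close>.\<close>

lemma lyapunov_decrease:
  "(\<integral>\<^sup>+cs. ennreal (lyapunov (marina_step cs st)) \<partial>draw)
      + ennreal (\<gamma> / 2) * ennreal ((norm (grad F (fst st)))\<^sup>2) \<le> ennreal (lyapunov st)"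
proof -
  obtain x g where st: "st = (x, g)" by force
  define x' where "x' = x - \<gamma> *\<^sub>R g"
  define G where "G = grad F x"
  define B where "B = F x' - fstar + (1 - p) * (\<gamma> / (2 * p))
        * ((norm (g - G))\<^sup>2 + \<omega> * L\<^sup>2 / real n * (norm (x' - x))\<^sup>2)"
  have "B \<ge> 0"
    using lower_bound \<gamma>_pos p \<omega>_pos by (simp add: B_def add_nonneg_nonneg)
  define E where "E = (norm (g - G))\<^sup>2"
  define N where "N = (norm g)\<^sup>2"
  define M where "M = (1 - p) * (\<gamma> / (2 * p)) * (E + \<omega> * L\<^sup>2 / real n * (norm (x' - x))\<^sup>2)"
  define P where "P = (\<gamma> * L)\<^sup>2 * ((1 - p) * \<omega> / (p * real n))"
  have D: "(norm (x' - x))\<^sup>2 = \<gamma>\<^sup>2 * N"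
    using \<gamma>_pos by (simp add: x'_def power_mult_distrib N_def)
  have "F x' \<le> F x + G \<bullet> (x' - x) + L / 2 * (\<gamma>\<^sup>2 * N)"
    unfolding G_def D[symmetric] by (rule smooth_with_descent[OF smooth_F])
  \<comment> \<open>Polarization of \<open>- \<gamma> * (G \<bullet> g)\<close>.\<close>
  moreover have "G \<bullet> (x' - x) = \<gamma> / 2 * E - \<gamma> / 2 * (norm G)\<^sup>2 - \<gamma> / 2 * N"
    by (simp add: x'_def power2_norm_eq_inner inner_diff_left inner_diff_right inner_commute
        algebra_simps E_def N_def)
  \<comment> \<open>Splitting \<open>(1 - p) / p\<close> as \<open>1 / p - 1\<close> yields the old
    Lyapunov weight and a term that cancels \<open>\<gamma> / 2 * E\<close> from
    polarization.\<close>
  moreover have "M = \<gamma> / (2 * p) * E - \<gamma> / 2 * E + \<gamma> / 2 * N * P"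
    unfolding M_def D P_def using p n by (simp add: field_simps power2_eq_square)
  moreover have "\<gamma> / 2 * N * P + L / 2 * (\<gamma>\<^sup>2 * N) \<le> \<gamma> / 2 * N"
  proof -
    have "\<gamma> / 2 * N * (P + \<gamma> * L) \<le> \<gamma> / 2 * N * 1"
      using \<gamma>_pos stepsize by (intro mult_left_mono) (auto simp: N_def P_def)
    then show ?thesis
      by (simp add: algebra_simps power2_eq_square)
  qed
  moreover have "B = F x' - fstar + M"
    by (simp add: B_def M_def E_def)
  moreover have "lyapunov (x, g) = F x - fstar + \<gamma> / (2 * p) * E"
    by (simp add: lyapunov_def E_def G_def)
  ultimately have "B + \<gamma> / 2 * (norm G)\<^sup>2 \<le> lyapunov (x, g)"
    by linarith
  have "(\<integral>\<^sup>+cs. ennreal (lyapunov (marina_step cs (x, g))) \<partial>draw)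
      + ennreal (\<gamma> / 2) * ennreal ((norm G)\<^sup>2) \<le> ennreal B + ennreal (\<gamma> / 2 * (norm G)\<^sup>2)"
    using nn_integral_lyapunov_step_le[of x g] \<gamma>_pos
    by (intro add_mono) (auto simp: B_def x'_def G_def simp flip: ennreal_mult)
  also have "\<dots> = ennreal (B + \<gamma> / 2 * (norm G)\<^sup>2)"
    using \<gamma>_pos \<open>B \<ge> 0\<close> by (simp flip: ennreal_plus)
  also have "\<dots> \<le> ennreal (lyapunov (x, g))"
    by (rule ennreal_leI) fact
  finally show ?thesis
    by (simp add: st G_def)
qed

lemma sum_nn_integral_grad_le:
  "ennreal (\<gamma> / 2) * (\<Sum>k<K. \<integral>\<^sup>+r. ennreal ((norm (grad F (iterate r k)))\<^sup>2) \<partial>run_space p n S)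
    \<le> ennreal (F x0 - fstar)"
proof -
  let ?R = "run_space p n S"
  define e where "e k = (\<integral>\<^sup>+r. ennreal ((norm (grad F (iterate r k)))\<^sup>2) \<partial>?R)" for k
  define \<Phi> where "\<Phi> k = (\<integral>\<^sup>+r. ennreal (lyapunov (state r k)) \<partial>?R)" for k
  have step: "\<Phi> (Suc k) + ennreal (\<gamma> / 2) * e k \<le> \<Phi> k" for k
  proof -
    have "\<Phi> (Suc k) = (\<integral>\<^sup>+r. (\<integral>\<^sup>+cs. ennreal (lyapunov (marina_step cs (state r k))) \<partial>draw) \<partial>?R)"
      unfolding \<Phi>_def state_Suc
      using nn_integral_state_draw[where k = k and h = "\<lambda>z. ennreal (lyapunov (marina_step (snd z) (fst z)))"]
      unfolding fst_conv snd_conv by measurable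
    then have "\<Phi> (Suc k) + ennreal (\<gamma> / 2) * e k
        = (\<integral>\<^sup>+r. (\<integral>\<^sup>+cs. ennreal (lyapunov (marina_step cs (state r k))) \<partial>draw)
            + ennreal (\<gamma> / 2) * ennreal ((norm (grad F (fst (state r k))))\<^sup>2) \<partial>?R)"
      unfolding e_def marina_x_def by (simp add: nn_integral_add nn_integral_cmult)
    also have "\<dots> \<le> \<Phi> k"
      unfolding \<Phi>_def by (intro nn_integral_mono lyapunov_decrease)
    finally show ?thesis .
  qed
  \<comment> \<open>Telescoping, with \<open>\<Phi> K\<close> kept on the left.\<close>
  have bound: "\<Phi> K + ennreal (\<gamma> / 2) * (\<Sum>k<K. e k) \<le> \<Phi> 0"
  proof (induction K)
    case (Suc K)
    have "\<Phi> (Suc K) + ennreal (\<gamma> / 2) * (\<Sum>k<Suc K. e k)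
        = (\<Phi> (Suc K) + ennreal (\<gamma> / 2) * e K) + ennreal (\<gamma> / 2) * (\<Sum>k<K. e k)"
      by (simp add: distrib_left ac_simps)
    also have "\<dots> \<le> \<Phi> K + ennreal (\<gamma> / 2) * (\<Sum>k<K. e k)"
      by (intro add_right_mono step)
    finally show ?case
      using Suc.IH by (rule order_trans)
  qed simp
  have "ennreal (\<gamma> / 2) * (\<Sum>k<K. e k) \<le> \<Phi> K + ennreal (\<gamma> / 2) * (\<Sum>k<K. e k)"
    by (simp add: add_increasing)
  also note bound
  \<comment> \<open>The start \<open>g^0 = grad F x0\<close> has no estimation error.\<close>
  also have "\<Phi> 0 = ennreal (F x0 - fstar)"
    by (simp add: \<Phi>_def lyapunov_def run.emeasure_space_1)
  finally show ?thesis
    by (simp add: e_def)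
qed

section \<open>The uniformly chosen output point\<close>

lemma output_measurable:
  assumes [measurable]: "\<And>j :: nat. h j \<in> measurable (run_space p n S) N"
  shows "(\<lambda>z. h (snd z) (fst z)) \<in> measurable (output_space p n S K) N"
  unfolding output_space_def
proof (rule measurable_compose_countable[where f = "\<lambda>j z. h j (fst z)" and g = snd])
  show "snd \<in> measurable (run_space p n S \<Otimes>\<^sub>M measure_pmf (pmf_of_set {..<K})) (count_space UNIV)"
    using measurable_snd[of "run_space p n S" "measure_pmf (pmf_of_set {..<K})"]
    by (simp add: measurable_cong_sets[OF refl sets_measure_pmf_count_space])
qed measurable

lemma nn_integral_output:
  assumes "K \<ge> 1" "\<And>j. h j \<in> borel_measurable (run_space p n S)"
  shows "(\<integral>\<^sup>+z. h (snd z) (fst z) \<partial>output_space p n S K)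
    = (\<Sum>j<K. \<integral>\<^sup>+r. h j r \<partial>run_space p n S) / of_nat K"
proof -
  have ne: "{..<K} \<noteq> {}"
    using assms(1) by (auto simp: lessThan_empty_iff)
  have [measurable]: "(\<lambda>z. h (snd z) (fst z))
      \<in> borel_measurable (run_space p n S \<Otimes>\<^sub>M measure_pmf (pmf_of_set {..<K}))"
    using output_measurable[OF assms(2)] by (simp add: output_space_def)
  have "(\<integral>\<^sup>+z. h (snd z) (fst z) \<partial>output_space p n S K)
      = (\<integral>\<^sup>+r. (\<integral>\<^sup>+j. h j r \<partial>pmf_of_set {..<K}) \<partial>run_space p n S)"
    unfolding output_space_def by (subst measure_pmf.nn_integral_fst[symmetric]) auto
  also have "\<dots> = (\<integral>\<^sup>+r. (\<Sum>j<K. h j r) / of_nat K \<partial>run_space p n S)"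
    using ne by (simp add: nn_integral_pmf_of_set)
  also have "\<dots> = (\<Sum>j<K. \<integral>\<^sup>+r. h j r \<partial>run_space p n S) / of_nat K"
    using assms(2) by (simp add: nn_integral_divide nn_integral_sum)
  finally show ?thesis .
qed

lemma output_grad_le:
  assumes "K \<ge> 1"
  shows "integrable (output_space p n S K) (\<lambda>(r, j). (norm (grad F (iterate r j)))\<^sup>2)" (is ?int)
    and "(\<integral>(r, j). (norm (grad F (iterate r j)))\<^sup>2 \<partial>output_space p n S K)
      \<le> 2 * (F x0 - fstar) / (\<gamma> * real K)" (is ?le)
proof -
  let ?h = "\<lambda>z. (norm (grad F (iterate (fst z) (snd z))))\<^sup>2"
  let ?O = "output_space p n S K"
  define T where "T = (\<Sum>k<K. \<integral>\<^sup>+r. ennreal ((norm (grad F (iterate r k)))\<^sup>2) \<partial>run_space p n S)"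
  have \<Delta>: "F x0 - fstar \<ge> 0"
    using lower_bound[of x0] by simp
  have "T = ennreal (2 / \<gamma>) * (ennreal (\<gamma> / 2) * T)"
    using \<gamma>_pos by (simp add: mult.assoc[symmetric] flip: ennreal_mult)
  also have "\<dots> \<le> ennreal (2 / \<gamma>) * ennreal (F x0 - fstar)"
    unfolding T_def by (intro mult_left_mono sum_nn_integral_grad_le) simp
  finally have T: "T \<le> ennreal (2 / \<gamma> * (F x0 - fstar))"
    using \<gamma>_pos \<Delta> by (subst ennreal_mult) auto
  have "(\<integral>\<^sup>+z. ennreal (?h z) \<partial>?O) = T / of_nat K"
    unfolding T_def
    by (rule nn_integral_output[OF assms, where h = "\<lambda>j r. ennreal ((norm (grad F (iterate r j)))\<^sup>2)"])
      measurable
  also have "\<dots> \<le> ennreal (2 / \<gamma> * (F x0 - fstar)) / of_nat K"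
    using T by (rule divide_right_mono_ennreal)
  also have "\<dots> = ennreal (2 * (F x0 - fstar) / (\<gamma> * real K))"
    using assms \<gamma>_pos \<Delta> by (simp add: divide_ennreal ennreal_of_nat_eq_real_of_nat)
  finally have nn: "(\<integral>\<^sup>+z. ennreal (?h z) \<partial>?O) \<le> ennreal (2 * (F x0 - fstar) / (\<gamma> * real K))" .
  have [measurable]: "(\<lambda>z. iterate (fst z) (snd z)) \<in> borel_measurable ?O"
    by (rule output_measurable) measurable
  \<comment> \<open>The finite bound on the nonnegative integral supplies integrability.\<close>
  have "integrable ?O ?h"
    using nn by (intro integrableI_nonneg) (auto simp: less_top[symmetric] top_unique)
  then show ?int
    by (simp only: case_prod_unfold)
  show ?le
    unfolding case_prod_unfold using nn \<Delta> \<gamma>_pos by (intro integral_real_bounded) auto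
qed

text \<open>For \<open>L = 0\<close> the linear model bounds \<open>F\<close> from above, so a
  nonzero gradient would make \<open>F\<close> unbounded below. This settles the complexity claim
  for \<open>L = 0\<close>, where no stepsize is prescribed.\<close>

lemma grad_F_eq_0:
  assumes "L = 0"
  shows "grad F x = 0"
proof (rule ccontr)
  assume "grad F x \<noteq> 0"
  then have pos: "(norm (grad F x))\<^sup>2 > 0"
    by simp
  \<comment> \<open>Long enough a step to push the linear model down to
    \<open>fstar - 1\<close>.\<close>
  define t where "t = (F x - fstar + 1) / (norm (grad F x))\<^sup>2"
  have "F (x - t *\<^sub>R grad F x) \<le> F x - t * (norm (grad F x))\<^sup>2"
    using smooth_with_descent[OF smooth_F, of "x - t *\<^sub>R grad F x" x] assms
    by (simp add: power2_norm_eq_inner)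
  also have "\<dots> = fstar - 1"
    using pos by (simp add: t_def)
  finally show False
    using lower_bound[of "x - t *\<^sub>R grad F x"] by simp
qed

subsection \<open>Communication cost\<close>

lemma integral_charged_cost:
  assumes "\<zeta> \<ge> 0"
  shows "(\<integral>r. charged_cost D \<zeta> K r \<partial>run_space p n S)
    = real D + real K * (p * real D + (1 - p) * \<zeta>)"
proof -
  let ?c = "\<lambda>cs :: bool \<times> (nat \<Rightarrow> 's). if fst cs then real D else \<zeta>"
  note [measurable] = coin_measurable[OF measurable_run_component]
  have [measurable]: "Measurable.pred draw fst"
    using coin_measurable[OF measurable_ident] by simp
  have "(\<integral>\<^sup>+cs. ennreal (?c cs) \<partial>draw) = ennreal (p * real D + (1 - p) * \<zeta>)"
    using p assms by (subst nn_integral_draw)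
      (auto simp: seeds.emeasure_space_1 ennreal_plus ennreal_mult)
  then have "(\<integral>cs. ?c cs \<partial>draw) = p * real D + (1 - p) * \<zeta>"
    using p assms by (subst integral_eq_nn_integral) (auto simp del: ennreal_plus)
  moreover have "(\<integral>r. ?c (r k) \<partial>run_space p n S) = (\<integral>cs. ?c cs \<partial>draw)" for k
  proof -
    have "(\<integral>r. ?c (r k) \<partial>run_space p n S)
        = (\<integral>cs. ?c cs \<partial>distr (run_space p n S) draw (\<lambda>r. r k))"
      by (rule integral_distr[symmetric]) measurable
    then show ?thesis
      by (simp only: distr_run_component)
  qed
  moreover have "integrable (run_space p n S) (\<lambda>r. ?c (r k))" for k
    using assms by (intro run.integrable_const_bound[where B = "max (real D) \<zeta>"]) auto
  ultimately show ?thesis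
    unfolding charged_cost_def by (simp add: run.prob_space)
qed

text \<open>The new point is determined by state \<open>k\<close> without draw \<open>k\<close>, so
  the message of iteration \<open>k\<close> is a function of that state and that draw.\<close>

lemma iterate_Suc: "iterate r (Suc k) = fst (state r k) - \<gamma> *\<^sub>R snd (state r k)"
  by (simp add: marina_x_def state_Suc marina_step_def Let_def del: marina.simps)

context
  fixes i :: nat
  assumes i: "i \<in> {1..n}"
begin

definition "msg_cost k r
  = real (nnz (marina_msg Q f (r k) i (iterate r k) (iterate r (Suc k))))"

text \<open>The conditional expectation of \<open>msg_cost\<close> given the two iterates.\<close>

definition "mean_msg_cost x x'
  = p * real (nnz (grad (f i) x')) + (1 - p) * density_at S Q (grad (f i) x' - grad (f i) x)"

lemma nn_integral_msg:
  "(\<integral>\<^sup>+cs. ennreal (real (nnz (marina_msg Q f cs i x x'))) \<partial>draw) = ennreal (mean_msg_cost x x')"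
proof -
  let ?v = "grad (f i) x' - grad (f i) x"
  have [measurable]: "(\<lambda>cs. marina_msg Q f cs i x x') \<in> borel_measurable draw"
    by (rule msg_measurable[OF i]) measurable
  have [measurable]: "(\<lambda>s. Q s ?v) \<in> borel_measurable S"
    by (rule quantization_measurable[OF quant]) auto
  have "(\<integral>\<^sup>+s. ennreal (real (nnz (Q (s i) ?v))) \<partial>(\<Pi>\<^sub>M i\<in>{1..n}. S))
      = (\<integral>\<^sup>+s. ennreal (real (nnz (Q s ?v))) \<partial>S)"
    by (rule nn_integral_seed[OF i]) measurable
  also have "\<dots> = ennreal (density_at S Q ?v)"
    unfolding density_at_def
    by (rule nn_integral_eq_integral) (auto intro: integrable_nnz_quantization[OF quant])
  finally have "(\<integral>\<^sup>+s. ennreal (real (nnz (Q (s i) ?v))) \<partial>(\<Pi>\<^sub>M i\<in>{1..n}. S))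
      = ennreal (density_at S Q ?v)" .
  then show ?thesis
    using p by (subst nn_integral_draw, measurable)
      (simp add: marina_msg_def seeds.emeasure_space_1 mean_msg_cost_def ennreal_mult
        density_at_nonneg)
qed

lemma mean_msg_cost_nonneg: "0 \<le> mean_msg_cost x x'"
  using p by (simp add: mean_msg_cost_def density_at_nonneg)

lemma mean_msg_cost_le:
  "mean_msg_cost x x' \<le> p * real CARD('d) + (1 - p) * expected_density S Q"
  unfolding mean_msg_cost_def using p
  by (intro add_mono mult_left_mono) (auto simp: nnz_le_CARD density_at_le_expected_density[OF quant])

lemma msg_cost_measurable [measurable]:
  "msg_cost k \<in> borel_measurable (run_space p n S)"
proof -
  have [measurable]: "(\<lambda>r. marina_msg Q f (r k) i (iterate r k) (iterate r (Suc k)))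
      \<in> borel_measurable (run_space p n S)"
    by (rule msg_measurable[OF i]) measurable
  show ?thesis
    unfolding msg_cost_def[abs_def] by measurable
qed

text \<open>The density at a random argument is an integral with parameter; joint measurability of
  \<open>Q\<close> in seed and vector makes it measurable in \<open>r\<close>.\<close>

lemma mean_msg_cost_measurable [measurable]:
  "(\<lambda>r. mean_msg_cost (iterate r k) (iterate r k')) \<in> borel_measurable (run_space p n S)"
proof -
  note [measurable] = grad_f_measurable[OF i]
  have [measurable]: "(\<lambda>z. Q (snd z) (grad (f i) (iterate (fst z) k') - grad (f i) (iterate (fst z) k)))
      \<in> borel_measurable (run_space p n S \<Otimes>\<^sub>M S)"
    by (rule quantization_measurable[OF quant]) measurable
  have [measurable]: "(\<lambda>r. density_at S Q (grad (f i) (iterate r k') - grad (f i) (iterate r k)))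
      \<in> borel_measurable (run_space p n S)"
    unfolding density_at_def
    by (rule S.borel_measurable_lebesgue_integral) (simp add: case_prod_unfold)
  show ?thesis
    unfolding mean_msg_cost_def by measurable
qed

lemma integrable_msg_cost: "integrable (run_space p n S) (msg_cost k)"
  by (rule run.integrable_const_bound[where B = "real CARD('d)"])
    (auto simp: msg_cost_def nnz_le_CARD)

lemma integrable_mean_msg_cost:
  "integrable (run_space p n S) (\<lambda>r. mean_msg_cost (iterate r k) (iterate r k'))"
  by (rule run.integrable_const_bound[where B = "p * real CARD('d) + (1 - p) * expected_density S Q"])
    (auto simp: mean_msg_cost_nonneg mean_msg_cost_le)

text \<open>The tower property: by \<open>nn_integral_state_draw\<close> the current draw is
  averaged out first, with both iterates fixed.\<close>

lemma integral_msg_cost: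
  "(\<integral>r. msg_cost k r \<partial>run_space p n S)
    = (\<integral>r. mean_msg_cost (iterate r k) (iterate r (Suc k)) \<partial>run_space p n S)"
proof -
  let ?msg = "\<lambda>st cs. ennreal (real (nnz (marina_msg Q f cs i (fst st) (fst st - \<gamma> *\<^sub>R snd st))))"
  have [measurable]: "(\<lambda>z. marina_msg Q f (snd z) i (fst (fst z)) (fst (fst z) - \<gamma> *\<^sub>R snd (fst z)))
      \<in> borel_measurable ((borel \<Otimes>\<^sub>M borel) \<Otimes>\<^sub>M draw)"
    by (rule msg_measurable[OF i]) measurable
  have "(\<integral>\<^sup>+r. ennreal (msg_cost k r) \<partial>run_space p n S)
      = (\<integral>\<^sup>+r. ?msg (state r k) (r k) \<partial>run_space p n S)"
    unfolding msg_cost_def iterate_Suc unfolding marina_x_def ..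
  also have "\<dots> = (\<integral>\<^sup>+r. (\<integral>\<^sup>+cs. ?msg (state r k) cs \<partial>draw) \<partial>run_space p n S)"
    using nn_integral_state_draw[where k = k and h = "\<lambda>z. ?msg (fst z) (snd z)"]
    unfolding fst_conv snd_conv by measurable
  also have "\<dots> = (\<integral>\<^sup>+r. ennreal (mean_msg_cost (iterate r k) (iterate r (Suc k)))
      \<partial>run_space p n S)"
    unfolding nn_integral_msg iterate_Suc unfolding marina_x_def ..
  finally have "(\<integral>\<^sup>+r. ennreal (msg_cost k r) \<partial>run_space p n S)
      = (\<integral>\<^sup>+r. ennreal (mean_msg_cost (iterate r k) (iterate r (Suc k))) \<partial>run_space p n S)" .
  moreover have "0 \<le> msg_cost k r" for r
    by (simp add: msg_cost_def)
  ultimately show ?thesis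
    by (subst (1 2) integral_eq_nn_integral) (auto simp: mean_msg_cost_nonneg)
qed

lemma sent_nnz_eq: "real (sent_nnz n f Q \<gamma> x0 i K r) = real (nnz (grad (f i) x0)) + (\<Sum>k<K. msg_cost k r)"
  by (simp add: sent_nnz_def msg_cost_def)

lemma integrable_sent_nnz:
  "integrable (run_space p n S) (\<lambda>r. real (sent_nnz n f Q \<gamma> x0 i K r))"
  unfolding sent_nnz_eq
  by (intro Bochner_Integration.integrable_add Bochner_Integration.integrable_sum integrable_msg_cost)
    simp

lemma integral_sent_nnz:
  "(\<integral>r. real (sent_nnz n f Q \<gamma> x0 i K r) \<partial>run_space p n S) = real (nnz (grad (f i) x0))
    + (\<Sum>k<K. \<integral>r. mean_msg_cost (iterate r k) (iterate r (Suc k)) \<partial>run_space p n S)"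
  unfolding sent_nnz_eq by (simp add: integrable_msg_cost integral_msg_cost run.prob_space)

lemma integral_sent_nnz_le:
  "(\<integral>r. real (sent_nnz n f Q \<gamma> x0 i K r) \<partial>run_space p n S)
    \<le> real CARD('d) + real K * (p * real CARD('d) + (1 - p) * expected_density S Q)"
proof -
  have "(\<integral>r. mean_msg_cost (iterate r k) (iterate r (Suc k)) \<partial>run_space p n S)
      \<le> p * real CARD('d) + (1 - p) * expected_density S Q" for k
    by (rule run.integral_le_const) (auto simp: integrable_mean_msg_cost mean_msg_cost_le)
  then have "(\<Sum>k<K. \<integral>r. mean_msg_cost (iterate r k) (iterate r (Suc k)) \<partial>run_space p n S)
      \<le> (\<Sum>k<K. p * real CARD('d) + (1 - p) * expected_density S Q)"
    by (intro sum_mono)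
  then show ?thesis
    unfolding integral_sent_nnz by (intro add_mono) (simp_all add: nnz_le_CARD)
qed

text \<open>The assumptions make every estimate behind \<open>integral_sent_nnz_le\<close> an
  equality almost surely.\<close>

lemma integral_sent_nnz_eq:
  assumes "nnz (grad (f i) x0) = CARD('d)"
    and "\<And>k. k < K \<Longrightarrow> AE r in run_space p n S.
      nnz (grad (f i) (iterate r (Suc k))) = CARD('d) \<and>
      density_at S Q (grad (f i) (iterate r (Suc k)) - grad (f i) (iterate r k))
        = expected_density S Q"
  shows "(\<integral>r. real (sent_nnz n f Q \<gamma> x0 i K r) \<partial>run_space p n S)
    = real CARD('d) + real K * (p * real CARD('d) + (1 - p) * expected_density S Q)"
proof -
  have "(\<integral>r. mean_msg_cost (iterate r k) (iterate r (Suc k)) \<partial>run_space p n S)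
      = (\<integral>r. p * real CARD('d) + (1 - p) * expected_density S Q \<partial>run_space p n S)"
    if "k < K" for k
  proof (rule integral_cong_AE)
    show "AE r in run_space p n S. mean_msg_cost (iterate r k) (iterate r (Suc k))
        = p * real CARD('d) + (1 - p) * expected_density S Q"
      using assms(2)[OF that] by eventually_elim (simp add: mean_msg_cost_def)
  qed auto
  then show ?thesis
    by (simp add: integral_sent_nnz assms(1) run.prob_space)
qed

end

end

text \<open>The cost formula is exact when each transmission is charged a fixed amount. For
  components actually sent it is an upper bound, as gradients may have zeros and the supremum in
  \<open>\<zeta>\<close> may not be attained. The asymptotic bounds are made explicit with the
  constant 4, at the largest admissible stepsize when \<open>L > 0\<close>.\<close>

theorem theoremC1:
  fixes f :: "nat \<Rightarrow> real ^ 'd \<Rightarrow> real"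
    and Li :: "nat \<Rightarrow> real"
    and S :: "'s measure"
    and Q :: "'s \<Rightarrow> real ^ 'd \<Rightarrow> real ^ 'd"
    and n :: nat
    and L p \<gamma> \<omega> \<zeta> fstar \<Delta>0 :: real
    and x0 :: "real ^ 'd"
  assumes n: "n \<ge> 1"
    and lower_bound: "\<forall>x. avg_fun n f x \<ge> fstar"
    and smooth: "\<forall>i\<in>{1..n}. smooth_with (Li i) (f i)"
    and quant: "quantization S Q \<omega>"
    and \<zeta>: "\<zeta> = expected_density S Q"
    and p: "0 < p" "p \<le> 1"
    and L: "L \<ge> 0" "L\<^sup>2 = (1 / real n) * (\<Sum>i=1..n. (Li i)\<^sup>2)"
    and \<gamma>_pos: "\<gamma> > 0"
    and \<gamma>_le: "L > 0 \<longrightarrow> \<gamma> \<le> 1 / (L * (1 + sqrt ((1 - p) * \<omega> / (p * real n))))"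
    and \<Delta>0: "\<Delta>0 = avg_fun n f x0 - fstar"
  shows
    "(\<forall>K\<ge>1.
        integrable (output_space p n S K)
          (\<lambda>(r, j). (norm (grad (avg_fun n f) (marina_x n f Q \<gamma> x0 r j)))\<^sup>2) \<and>
        (\<integral>(r, j). (norm (grad (avg_fun n f) (marina_x n f Q \<gamma> x0 r j)))\<^sup>2
           \<partial>output_space p n S K) \<le> 2 * \<Delta>0 / (\<gamma> * real K))
     \<and>
     (\<forall>K.
        (\<integral>r. charged_cost CARD('d) \<zeta> K r \<partial>run_space p n S)
          = real CARD('d) + real K * (p * real CARD('d) + (1 - p) * \<zeta>) \<and>
        (\<forall>i\<in>{1..n}.
           integrable (run_space p n S) (\<lambda>r. real (sent_nnz n f Q \<gamma> x0 i K r)) \<and>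
           (\<integral>r. real (sent_nnz n f Q \<gamma> x0 i K r) \<partial>run_space p n S)
             \<le> real CARD('d) + real K * (p * real CARD('d) + (1 - p) * \<zeta>) \<and>
           (nnz (grad (f i) x0) = CARD('d) \<and>
            (\<forall>k<K. AE r in run_space p n S.
               nnz (grad (f i) (marina_x n f Q \<gamma> x0 r (Suc k))) = CARD('d) \<and>
               density_at S Q (grad (f i) (marina_x n f Q \<gamma> x0 r (Suc k))
                               - grad (f i) (marina_x n f Q \<gamma> x0 r k)) = \<zeta>)
            \<longrightarrow> (\<integral>r. real (sent_nnz n f Q \<gamma> x0 i K r) \<partial>run_space p n S)
                  = real CARD('d) + real K * (p * real CARD('d) + (1 - p) * \<zeta>))))
     \<and>
     ((L > 0 \<longrightarrow> \<gamma> = 1 / (L * (1 + sqrt ((1 - p) * \<omega> / (p * real n))))) \<longrightarrow>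
      (\<forall>\<epsilon>>0. \<exists>K0\<ge>1.
         real K0 \<le> max 1 (4 * (\<Delta>0 * L / \<epsilon>\<^sup>2 * (1 + sqrt ((1 - p) * \<omega> / (p * real n))))) \<and>
         (\<forall>K\<ge>K0.
            (\<integral>(r, j). (norm (grad (avg_fun n f) (marina_x n f Q \<gamma> x0 r j)))\<^sup>2
               \<partial>output_space p n S K) \<le> \<epsilon>\<^sup>2) \<and>
         real CARD('d) + real K0 * (p * real CARD('d) + (1 - p) * \<zeta>)
           \<le> 4 * (real CARD('d)
                  + \<Delta>0 * L / \<epsilon>\<^sup>2 * (1 + sqrt ((1 - p) * \<omega> / (p * real n)))
                    * (p * real CARD('d) + (1 - p) * \<zeta>))))"
proof -
  define s where "s = sqrt ((1 - p) * \<omega> / (p * real n))"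
  have \<omega>: "\<omega> > 0"
    using quant by (simp add: quantization_def)
  have s: "s \<ge> 0"
    using p \<omega> by (simp add: s_def)
  have "\<gamma> * L * (1 + s) \<le> 1"
  proof (cases "L = 0")
    case False
    with L(1) s have "L * (1 + s) > 0"
      by (intro mult_pos_pos) auto
    then show ?thesis
      using \<gamma>_le False L(1) by (simp add: pos_le_divide_eq mult.assoc flip: s_def)
  qed simp
  then interpret marina_setting f Li S Q n L p \<gamma> \<omega> fstar x0
    using assms by unfold_locales (auto simp: s_def)
  let ?d = "real CARD('d)"
  let ?rate = "p * ?d + (1 - p) * \<zeta>"
  have \<zeta>_nonneg: "\<zeta> \<ge> 0" and \<zeta>_le: "\<zeta> \<le> ?d"
    unfolding \<zeta> using expected_density_nonneg[OF quant] expected_density_le_CARD[OF quant] .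
  have \<Delta>0_nonneg: "\<Delta>0 \<ge> 0"
    using lower_bound \<Delta>0 by simp
  have rate: "0 \<le> ?rate" "?rate \<le> ?d"
  proof -
    show "0 \<le> ?rate"
      using p \<zeta>_nonneg by simp
    show "?rate \<le> ?d"
      using p mult_left_mono[OF \<zeta>_le, of "1 - p"] by (simp add: algebra_simps)
  qed
  have complexity: "\<exists>K0\<ge>1. real K0 \<le> max 1 (4 * (\<Delta>0 * L / \<epsilon>\<^sup>2 * (1 + s))) \<and>
      (\<forall>K\<ge>K0. (\<integral>(r, j). (norm (grad (avg_fun n f) (marina_x n f Q \<gamma> x0 r j)))\<^sup>2
         \<partial>output_space p n S K) \<le> \<epsilon>\<^sup>2) \<and>
      ?d + real K0 * ?rate \<le> 4 * (?d + \<Delta>0 * L / \<epsilon>\<^sup>2 * (1 + s) * ?rate)"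
    if \<gamma>_eq: "L > 0 \<longrightarrow> \<gamma> = 1 / (L * (1 + s))" and \<epsilon>: "\<epsilon> > 0" for \<epsilon> :: real
  proof -
    define A where "A = \<Delta>0 * L / \<epsilon>\<^sup>2 * (1 + s)"
    have A: "A \<ge> 0"
      using \<Delta>0_nonneg L(1) s by (simp add: A_def)
    \<comment> \<open>With \<open>\<gamma> = 1 / (L * (1 + s))\<close>, the rate
      \<open>2 * \<Delta>0 / (\<gamma> * K)\<close> is at most \<open>\<epsilon>\<^sup>2\<close>
      once \<open>K \<ge> 2 * A\<close>. At least one iterate is needed to choose from.\<close>
    define K0 where "K0 = max 1 (nat \<lceil>2 * A\<rceil>)"
    have K0: "K0 \<ge> 1" "2 * A \<le> real K0"
      unfolding K0_def by linarith+
    have K0_le: "real K0 \<le> max 1 (4 * A)"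
    proof (cases "2 * A \<le> 1")
      case True
      then have "\<lceil>2 * A\<rceil> \<le> 1"
        by (simp add: ceiling_le_iff)
      then have "K0 = 1"
        unfolding K0_def by linarith
      then show ?thesis
        by simp
    next
      \<comment> \<open>Rounding up costs at most 1, which is below \<open>2 * A\<close> here; this
        is the source of the constant 4.\<close>
      case False
      then have "real (nat \<lceil>2 * A\<rceil>) \<le> 4 * A"
        by linarith
      then show ?thesis
        by (auto simp: K0_def)
    qed
    have "(\<integral>(r, j). (norm (grad (avg_fun n f) (marina_x n f Q \<gamma> x0 r j)))\<^sup>2
         \<partial>output_space p n S K) \<le> \<epsilon>\<^sup>2" if K: "K \<ge> K0" for K
    proof (cases "L = 0")
      case True
      then show ?thesis
        by (simp add: grad_F_eq_0 case_prod_unfold)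
    next
      case False
      then have "L > 0"
        using L(1) by simp
      have "K \<ge> 1"
        using K K0(1) by simp
      have "2 * A \<le> real K"
        using K K0(2) by linarith
      then have "2 * \<Delta>0 * (L * (1 + s)) \<le> \<epsilon>\<^sup>2 * real K"
        using \<epsilon> by (simp add: A_def field_simps)
      then have "2 * \<Delta>0 / (\<gamma> * real K) \<le> \<epsilon>\<^sup>2"
        using \<gamma>_eq \<open>L > 0\<close> \<open>K \<ge> 1\<close> by (simp add: pos_divide_le_eq)
      then show ?thesis
        using output_grad_le(2)[OF \<open>K \<ge> 1\<close>] by (simp add: \<Delta>0)
    qed
    moreover have "?d + real K0 * ?rate \<le> 4 * (?d + A * ?rate)"
    proof (cases "K0 = 1")
      \<comment> \<open>A single iteration costs at most \<open>?d\<close> because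
        \<open>?rate \<le> ?d\<close>, so it is absorbed by the term \<open>4 * ?d\<close>.\<close>
      case True
      have "0 \<le> A * ?rate"
        using A rate by simp
      with True rate show ?thesis
        by simp
    next
      case False
      then have "real K0 \<le> 4 * A"
        using K0(1) K0_le by (simp add: max_def split: if_splits)
      then have "real K0 * ?rate \<le> 4 * A * ?rate"
        using rate(1) by (rule mult_right_mono)
      then show ?thesis
        by simp
    qed
    ultimately show ?thesis
      using K0(1) K0_le unfolding A_def by blast
  qed
  show ?thesis
    using output_grad_le integral_charged_cost[OF \<zeta>_nonneg] integrable_sent_nnz
      integral_sent_nnz_le integral_sent_nnz_eq complexity
    unfolding \<Delta>0 \<zeta> s_def by blast
qed

end
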